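(* Let $J\subset\{1,\dots,m\}$ and $(\overline{x},\overline{\lambda})\in\mathbb{R}^n\times\mathbb{R}^m$. (i) Assume that $(\overline{x},\overline{\lambda})$ is a $J$-LKKT point of $L$. Then $\overline{x}$ is a $J$-LKKT point of $(P_J)$, $\overline{x}\in X_J$, $\overline{\lambda}\in Y_{\mathrm{col}}^{J}$, and $q_0(\overline{x})=L(\overline{x},\overline{\lambda})=D(\overline{\lambda})$; moreover, if $\overline{\lambda}\in Y_{\mathrm{col}}^{J+}$ then $$q_0(\overline{x})=\inf_{x\in X_J}q_0(x)=L(\overline{x},\overline{\lambda})=\sup_{\lambda\in Y_{\mathrm{col}}^{J+}}D(\lambda)=D(\overline{\lambda}).$$ (ii) Assume that $(\overline{x},\overline{\lambda})$ is a $J$-LKKT point of $L$ with $\overline{\lambda}\in Y_0$ (or, equivalently, $\overline{\lambda}\in Y^J$). Then $\overline{x}=A(\overline{\lambda})^{-1}b(\overline{\lambda})$, and $\overline{\lambda}$ is a $J$-LKKT point of $D$; moreover, $\overline{x}$ is the unique global minimizer of $q_0$ on $X_J$ if $\overline{\lambda}\in Y^{J+}$. Conversely, assume that $\overline{\lambda}\in Y_0$ is a $J$-LKKT point of $D$. Then $(\overline{x},\overline{\lambda})$ is a $J$-LKKT point of $L$, where $\overline{x}:=A(\overline{\lambda})^{-1}b(\overline{\lambda})$; consequently the conclusions of (i) and (ii) hold for it. (iii) Assume that $\overline{\lambda}\in Y^{J+}$. Then $$D(\overline{\lambda})=\sup_{\lambda\in Y_{\mathrm{col}}^{J+}}D(\lambda)\iff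 D(\overline{\lambda})=\sup_{\lambda\in Y^{J+}}D(\lambda)\iff\overline{\lambda}\text{ is a }J\text{-LKKT point of }D.$$
   Context: For $k\in\{0,1,\dots,m\}$ let $q_k:\mathbb{R}^n\to\mathbb{R}$, $q_k(x):=\tfrac12\langle x,A_kx\rangle-\langle b_k,x\rangle+c_k$, where $A_k$ is a given real symmetric $n\times n$ matrix, $b_k\in\mathbb{R}^n$, $c_k\in\mathbb{R}$. For $J\subset\{1,\dots,m\}$ put $J^c:=\{1,\dots,m\}\setminus J$, $X_J:=\{x\in\mathbb{R}^n\mid q_j(x)=0\ \forall j\in J,\ q_j(x)\le0\ \forall j\in J^c\}$, $\Gamma_J:=\{\lambda\in\mathbb{R}^m\mid\lambda_j\ge0\ \forall j\in J^c\}$. Problem $(P_J)$ is: minimize $q_0(x)$ subject to $x\in X_J$. For $\lambda\in\mathbb{R}^m$, with $\lambda_0:=1$, put $A(\lambda):=\sum_{k=0}^m\lambda_kA_k$, $b(\lambda):=\sum_{k=0}^m\lambda_kb_k$, $c(\lambda):=\sum_{k=0}^m\lambda_kc_k$. The Lagrangian is $L:\mathbb{R}^n\times\mathbb{R}^m\to\mathbb{R}$, $L(x,\lambda):=q_0(x)+\sum_{j=1}^m\lambda_jq_j(x)=\tfrac12\langle x,A(\lambda)x\rangle-\langle x,b(\lambda)\rangle+c(\lambda)$. Sets ($\succ0$, $\succeq0$ mean positive definite, positive semidefinite): $Y_0:=\{\lambda\in\mathbb{R}^m\mid\det A(\lambda)\ne0\}$, $Y^{+}:=\{\lambda\mid A(\lambda)\succ0\}$,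 $Y_{\mathrm{col}}:=\{\lambda\mid b(\lambda)\in\operatorname{Im}A(\lambda)\}$, $Y_{\mathrm{col}}^{+}:=\{\lambda\in Y_{\mathrm{col}}\mid A(\lambda)\succeq0\}$; $Y^J:=\Gamma_J\cap Y_0$, $Y^{J+}:=\Gamma_J\cap Y^+$, $Y_{\mathrm{col}}^J:=\Gamma_J\cap Y_{\mathrm{col}}$, $Y_{\mathrm{col}}^{J+}:=\Gamma_J\cap Y_{\mathrm{col}}^+$. The dual function is $D:Y_{\mathrm{col}}\to\mathbb{R}$, $D(\lambda):=L(x,\lambda)$ for any $x$ with $A(\lambda)x=b(\lambda)$ (the value does not depend on the choice of such $x$). On the open set $Y_0\subset Y_{\mathrm{col}}$ one has $D(\lambda)=-\tfrac12\langle b(\lambda),A(\lambda)^{-1}b(\lambda)\rangle+c(\lambda)$, which is smooth. $(\overline{x},\overline{\lambda})$ is a $J$-LKKT point of $L$ if $\nabla_xL(\overline{x},\overline{\lambda})=0$; for all $j\in J^c$: $\overline{\lambda}_j\ge0$, $\frac{\partial L}{\partial\lambda_j}(\overline{x},\overline{\lambda})\le0$ and $\overline{\lambda}_j\frac{\partial L}{\partial\lambda_j}(\overline{x},\overline{\lambda})=0$; and for all $j\in J$: $\frac{\partial L}{\partial\lambda_j}(\overline{x},\overline{\lambda})=0$. (Note $\frac{\partial L}{\partial\lambda_j}(x,\lambda)=q_j(x)$.) A point $\overline{x}\in\mathbb{R}^n$ is a $J$-LKKT point of $(P_J)$ if there is $\overline{\lambda}\in\mathbb{R}^m$ such that $(\overline{x},\overline{\lambda})$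 is a $J$-LKKT point of $L$. A point $\overline{\lambda}\in Y_0$ is a $J$-LKKT point of $D$ if for all $j\in J^c$: $\overline{\lambda}_j\ge0$, $\frac{\partial D}{\partial\lambda_j}(\overline{\lambda})\le0$ and $\overline{\lambda}_j\frac{\partial D}{\partial\lambda_j}(\overline{\lambda})=0$; and for all $j\in J$: $\frac{\partial D}{\partial\lambda_j}(\overline{\lambda})=0$. *)

theory Defs
  imports "HOL-Analysis.Analysis"
begin

text \<open>The index set of the data \<open>A\<^sub>k, b\<^sub>k, c\<^sub>k\<close> with \<open>k \<in> {0,\<dots>,m}\<close> is the type \<open>'m option\<close>:
  \<open>None\<close> plays the role of \<open>0\<close> (the objective) and \<open>Some j\<close>, with \<open>j :: 'm\<close>, that of
  \<open>j \<in> {1,\<dots>,m}\<close> (the constraints). Hence \<open>m = CARD('m)\<close>, \<open>n = CARD('n)\<close>, and the complement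
  \<open>- J\<close> of \<open>J :: 'm set\<close> is \<open>{1,\<dots>,m} - J\<close>.\<close>

definition positive_definite :: "real^'n^'n \<Rightarrow> bool" where
  "positive_definite M \<longleftrightarrow> transpose M = M \<and> (\<forall>x. x \<noteq> 0 \<longrightarrow> x \<bullet> (M *v x) > 0)"

definition positive_semidefinite :: "real^'n^'n \<Rightarrow> bool" where
  "positive_semidefinite M \<longleftrightarrow> transpose M = M \<and> (\<forall>x. x \<bullet> (M *v x) \<ge> 0)"

definition partial_deriv :: "(real^'m \<Rightarrow> real) \<Rightarrow> 'm::finite \<Rightarrow> real^'m \<Rightarrow> real" where
  "partial_deriv f j v = deriv (\<lambda>t. f (v + t *\<^sub>R axis j 1)) 0"

definition quad :: "('k \<Rightarrow> real^'n^'n) \<Rightarrow> ('k \<Rightarrow> real^'n) \<Rightarrow> ('k \<Rightarrow> real) \<Rightarrow> 'k \<Rightarrow> real^'n \<Rightarrow> real" where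
  "quad A b c k x = 1/2 * (x \<bullet> (A k *v x)) - b k \<bullet> x + c k"

definition feasible ::
  "('m option \<Rightarrow> real^'n^'n) \<Rightarrow> ('m option \<Rightarrow> real^'n) \<Rightarrow> ('m option \<Rightarrow> real) \<Rightarrow> 'm set \<Rightarrow> (real^'n) set" where
  "feasible A b c J =
     {x. (\<forall>j\<in>J. quad A b c (Some j) x = 0) \<and> (\<forall>j\<in>-J. quad A b c (Some j) x \<le> 0)}"

definition GammaJ :: "'m::finite set \<Rightarrow> (real^'m) set" where
  "GammaJ J = {l. \<forall>j\<in>-J. l $ j \<ge> 0}"

text \<open>The convention \<open>\<lambda>\<^sub>0 := 1\<close>.\<close>

definition multiplier :: "real^'m \<Rightarrow> 'm::finite option \<Rightarrow> real" where
  "multiplier l k = (case k of None \<Rightarrow> 1 | Some j \<Rightarrow> l $ j)"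

definition comb :: "('m::finite option \<Rightarrow> 'v::real_vector) \<Rightarrow> real^'m \<Rightarrow> 'v" where
  "comb F l = (\<Sum>k\<in>UNIV. multiplier l k *\<^sub>R F k)"

definition lagr ::
  "('m::finite option \<Rightarrow> real^'n^'n) \<Rightarrow> ('m option \<Rightarrow> real^'n) \<Rightarrow> ('m option \<Rightarrow> real) \<Rightarrow>
     real^'n \<Rightarrow> real^'m \<Rightarrow> real" where
  "lagr A b c x l = quad A b c None x + (\<Sum>j\<in>UNIV. l $ j * quad A b c (Some j) x)"

definition Y0 :: "('m::finite option \<Rightarrow> real^'n^'n) \<Rightarrow> (real^'m) set" where
  "Y0 A = {l. det (comb A l) \<noteq> 0}"

definition Yp :: "('m::finite option \<Rightarrow> real^'n^'n) \<Rightarrow> (real^'m) set" where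
  "Yp A = {l. positive_definite (comb A l)}"

definition Ycol :: "('m::finite option \<Rightarrow> real^'n^'n) \<Rightarrow> ('m option \<Rightarrow> real^'n) \<Rightarrow> (real^'m) set" where
  "Ycol A b = {l. comb b l \<in> range (\<lambda>x. comb A l *v x)}"

definition Ycolp :: "('m::finite option \<Rightarrow> real^'n^'n) \<Rightarrow> ('m option \<Rightarrow> real^'n) \<Rightarrow> (real^'m) set" where
  "Ycolp A b = {l \<in> Ycol A b. positive_semidefinite (comb A l)}"

definition YJ :: "('m::finite option \<Rightarrow> real^'n^'n) \<Rightarrow> 'm set \<Rightarrow> (real^'m) set" where
  "YJ A J = GammaJ J \<inter> Y0 A"

definition YJp :: "('m::finite option \<Rightarrow> real^'n^'n) \<Rightarrow> 'm set \<Rightarrow> (real^'m) set" where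
  "YJp A J = GammaJ J \<inter> Yp A"

definition YcolJ ::
  "('m::finite option \<Rightarrow> real^'n^'n) \<Rightarrow> ('m option \<Rightarrow> real^'n) \<Rightarrow> 'm set \<Rightarrow> (real^'m) set" where
  "YcolJ A b J = GammaJ J \<inter> Ycol A b"

definition YcolJp ::
  "('m::finite option \<Rightarrow> real^'n^'n) \<Rightarrow> ('m option \<Rightarrow> real^'n) \<Rightarrow> 'm set \<Rightarrow> (real^'m) set" where
  "YcolJp A b J = GammaJ J \<inter> Ycolp A b"

text \<open>The dual function; its value is meaningful on \<^term>\<open>Ycol A b\<close> only, where by \<open>dual_eq\<close> below it
  does not depend on the chosen solution. Since \<^term>\<open>Y0 A\<close> is an open subset of \<^term>\<open>Ycol A b\<close>,
  the partial derivatives at points of \<^term>\<open>Y0 A\<close> do not see the values outside \<^term>\<open>Ycol A b\<close>.\<close>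

definition dual ::
  "('m::finite option \<Rightarrow> real^'n^'n) \<Rightarrow> ('m option \<Rightarrow> real^'n) \<Rightarrow> ('m option \<Rightarrow> real) \<Rightarrow> real^'m \<Rightarrow> real" where
  "dual A b c l = lagr A b c (SOME x. comb A l *v x = comb b l) l"

definition LKKT_L ::
  "('m::finite option \<Rightarrow> real^'n^'n) \<Rightarrow> ('m option \<Rightarrow> real^'n) \<Rightarrow> ('m option \<Rightarrow> real) \<Rightarrow>
     'm set \<Rightarrow> real^'n \<Rightarrow> real^'m \<Rightarrow> bool" where
  "LKKT_L A b c J x l \<longleftrightarrow>
     GDERIV (\<lambda>y. lagr A b c y l) x :> 0 \<and>
     (\<forall>j\<in>-J. l $ j \<ge> 0 \<and> partial_deriv (lagr A b c x) j l \<le> 0 \<and>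
              l $ j * partial_deriv (lagr A b c x) j l = 0) \<and>
     (\<forall>j\<in>J. partial_deriv (lagr A b c x) j l = 0)"

definition LKKT_P ::
  "('m::finite option \<Rightarrow> real^'n^'n) \<Rightarrow> ('m option \<Rightarrow> real^'n) \<Rightarrow> ('m option \<Rightarrow> real) \<Rightarrow>
     'm set \<Rightarrow> real^'n \<Rightarrow> bool" where
  "LKKT_P A b c J x \<longleftrightarrow> (\<exists>l. LKKT_L A b c J x l)"

definition LKKT_D ::
  "('m::finite option \<Rightarrow> real^'n^'n) \<Rightarrow> ('m option \<Rightarrow> real^'n) \<Rightarrow> ('m option \<Rightarrow> real) \<Rightarrow>
     'm set \<Rightarrow> real^'m \<Rightarrow> bool" where
  "LKKT_D A b c J l \<longleftrightarrow>
     l \<in> Y0 A \<and>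
     (\<forall>j\<in>-J. l $ j \<ge> 0 \<and> partial_deriv (dual A b c) j l \<le> 0 \<and>
              l $ j * partial_deriv (dual A b c) j l = 0) \<and>
     (\<forall>j\<in>J. partial_deriv (dual A b c) j l = 0)"

lemma comb_split: "comb F l = F None + (\<Sum>j\<in>UNIV. l $ j *\<^sub>R F (Some j))"
proof -
  have "comb F l = (\<Sum>k\<in>insert None (range Some). multiplier l k *\<^sub>R F k)"
    by (simp add: comb_def UNIV_option_conv)
  also have "\<dots> = multiplier l None *\<^sub>R F None + (\<Sum>k\<in>range Some. multiplier l k *\<^sub>R F k)"
    by (rule sum.insert) auto
  also have "(\<Sum>k\<in>range Some. multiplier l k *\<^sub>R F k) = (\<Sum>j\<in>UNIV. multiplier l (Some j) *\<^sub>R F (Some j))"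
    by (simp add: sum.reindex)
  finally show ?thesis by (simp add: multiplier_def)
qed

lemma comb_matrix_vector:
  fixes A :: "'m::finite option \<Rightarrow> real^'n^'k"
  shows "comb A l *v x = comb (\<lambda>k. A k *v x) l"
proof -
  have lin: "linear (\<lambda>M :: real^'n^'k. M *v x)"
    by (rule linearI) (simp_all add: matrix_vector_mult_add_rdistrib scaleR_matrix_vector_assoc)
  show ?thesis
    unfolding comb_def linear_sum[OF lin] by (simp add: scaleR_matrix_vector_assoc)
qed

lemma inner_comb: "x \<bullet> comb F l = comb (\<lambda>k. x \<bullet> F k) l"
  by (simp add: comb_def inner_sum_right)

lemma lagr_eq: "lagr A b c x l = 1/2 * (x \<bullet> (comb A l *v x)) - x \<bullet> comb b l + comb c l"
proof -
  have comb_quad: "lagr A b c x l = comb (\<lambda>k. quad A b c k x) l"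
    by (simp add: lagr_def comb_split)
  have "multiplier l k *\<^sub>R quad A b c k x =
      1/2 * (multiplier l k *\<^sub>R (x \<bullet> (A k *v x))) - multiplier l k *\<^sub>R (x \<bullet> b k) + multiplier l k *\<^sub>R c k" for k
    by (simp add: quad_def inner_commute[of "b k"] distrib_left right_diff_distrib)
  then show ?thesis
    unfolding comb_quad comb_matrix_vector inner_comb
    by (simp add: comb_def sum.distrib sum_subtractf flip: sum_distrib_left sum_divide_distrib)
qed

lemma transpose_comb:
  assumes "\<And>k. transpose (A k) = A k"
  shows "transpose (comb A l) = comb A l"
proof -
  have "A k $ i $ j = A k $ j $ i" for k i j
    using arg_cong[OF assms[of k], of "\<lambda>M. M $ j $ i"] by (simp add: transpose_def)
  then show ?thesis
    by (simp add: comb_def transpose_def vec_eq_iff)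
qed

lemma dual_eq:
  assumes sym: "\<And>k. transpose (A k) = A k" and x: "comb A l *v x = comb b l"
  shows "dual A b c l = lagr A b c x l"
proof -
  define y where "y = (SOME x. comb A l *v x = comb b l)"
  have y: "comb A l *v y = comb b l"
    unfolding y_def using x by (rule someI)
  have "x \<bullet> (comb A l *v y) = (comb A l *v x) \<bullet> y"
    unfolding dot_lmul_matrix[symmetric] transpose_matrix_vector[symmetric] transpose_comb[OF sym] ..
  then have "x \<bullet> comb b l = y \<bullet> comb b l"
    using x y by (simp add: inner_commute)
  then show ?thesis
    unfolding dual_def y_def[symmetric] lagr_eq x y by simp
qed

lemma partial_deriv_lagr: "partial_deriv (lagr A b c x) j l = quad A b c (Some j) x"
proof -
  have "(\<Sum>i\<in>UNIV. axis j 1 $ i * quad A b c (Some i) x) = (\<Sum>i\<in>{j}. quad A b c (Some i) x)"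
    by (rule sum.mono_neutral_cong_right) (auto simp: axis_def)
  then have "lagr A b c x (l + t *\<^sub>R axis j 1) = lagr A b c x l + t * quad A b c (Some j) x" for t
    by (simp add: lagr_def distrib_right sum.distrib mult.assoc flip: sum_distrib_left)
  then show ?thesis
    unfolding partial_deriv_def
    by (auto intro!: DERIV_imp_deriv derivative_eq_intros)
qed

end

theory Submission
  imports Defs
begin

text \<open>If \<open>A(\<lambda>) x = b(\<lambda>)\<close>, completing the square gives
  \<open>L(y,\<lambda>) = D(\<lambda>) + \<langle>y - x, A(\<lambda>)(y - x)\<rangle> / 2\<close>. When \<open>A(\<lambda>)\<close> is positive semidefinite this says that
  \<open>L(\<cdot>,\<lambda>)\<close> is minimal at \<open>x\<close>, so \<open>D(\<lambda>) \<le> L(y,\<lambda>) \<le> q\<^sub>0(y)\<close> for feasible \<open>y\<close>, with equalities at a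
  \<open>J\<close>-LKKT point: this is (i). The same identity, applied on the line \<open>\<lambda> + t e\<^sub>j\<close> with \<open>y\<close> the solution at
  \<open>t = 0\<close>, shows that \<open>D\<close> and \<open>L(y,\<cdot>)\<close> differ by \<open>O(t\<^sup>2)\<close>, so \<open>\<partial>D/\<partial>\<lambda>\<^sub>j = q\<^sub>j(y)\<close>, which
  identifies the \<open>J\<close>-LKKT points of \<open>D\<close> with those of \<open>L\<close>. Finally, \<open>\<Gamma>\<^sub>J \<inter> Y\<^sup>+\<close> contains a
  (one- or two-sided) neighbourhood of each of its points in the coordinate directions, so a maximizer
  of \<open>D\<close> over it satisfies the \<open>J\<close>-LKKT conditions.\<close>

section \<open>The Lagrangian: completion of the square, weak duality bounds and stationarity in
  x\<close>

lemma comb_add_axis: "comb F (l + t *\<^sub>R axis j 1) = comb F l + t *\<^sub>R F (Some j)"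
proof -
  have "(\<Sum>i\<in>UNIV. (axis j (1::real) $ i) *\<^sub>R F (Some i)) = (\<Sum>i\<in>{j}. (axis j 1 $ i) *\<^sub>R F (Some i))"
    by (rule sum.mono_neutral_cong_right) (auto simp: axis_def)
  then show ?thesis
    by (simp add: comb_split scaleR_add_left sum.distrib flip: scaleR_sum_right scaleR_scaleR)
qed

lemma inner_comb_symmetric:
  fixes A :: "'m::finite option \<Rightarrow> real^'n^'n"
  assumes "\<And>k. transpose (A k) = A k"
  shows "x \<bullet> (comb A l *v y) = y \<bullet> (comb A l *v x)"
proof -
  have "x \<bullet> (comb A l *v y) = (transpose (comb A l) *v x) \<bullet> y"
    by (simp add: dot_lmul_matrix)
  then show ?thesis
    by (simp add: transpose_comb[of A, OF assms] inner_commute)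
qed

text \<open>By symmetry the cross terms of the square both equal
  \<open>y \<bullet> comb b l\<close>, and the rest of the expansion is the dual value. No sign of
  \<open>comb A l\<close> enters, so the identity also serves for the derivative of the dual at
  indefinite matrices.\<close>

lemma lagr_complete_square:
  assumes sym: "\<And>k. transpose (A k) = A k" and x: "comb A l *v x = comb b l"
  shows "lagr A b c y l = dual A b c l + 1/2 * ((y - x) \<bullet> (comb A l *v (y - x)))"
proof -
  have "x \<bullet> (comb A l *v y) = y \<bullet> comb b l"
    using inner_comb_symmetric[of A, OF sym, of x l y] x by simp
  then show ?thesis
    unfolding dual_eq[of A, OF sym x] lagr_eq
    by (simp add: matrix_vector_mult_diff_distrib x inner_diff_left inner_diff_right field_simps)
qed

lemma dual_le_lagr:
  assumes "\<And>k. transpose (A k) = A k" and "l \<in> Ycolp A b"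
  shows "dual A b c l \<le> lagr A b c y l"
proof -
  obtain x where x: "comb A l *v x = comb b l"
    using assms(2) by (auto simp: Ycolp_def Ycol_def)
  show ?thesis
    unfolding lagr_complete_square[of A, OF assms(1) x]
    using assms(2) by (simp add: Ycolp_def positive_semidefinite_def)
qed

text \<open>Each constraint term is at most 0: it vanishes for j in J, and otherwise is the product
  of a nonnegative multiplier and a nonpositive value.\<close>

lemma lagr_le_quad:
  assumes "x \<in> feasible A b c J" "l \<in> GammaJ J"
  shows "lagr A b c x l \<le> quad A b c None x"
proof -
  have "l $ j * quad A b c (Some j) x \<le> 0" for j
    using assms by (cases "j \<in> J") (auto simp: feasible_def GammaJ_def mult_nonneg_nonpos)
  then show ?thesis
    by (simp add: lagr_def sum_nonpos)
qed

lemma gderiv_lagr: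
  assumes "\<And>k. transpose (A k) = A k"
  shows "GDERIV (\<lambda>y. lagr A b c y l) x :> comb A l *v x - comb b l"
proof -
  have "((\<lambda>y. 1/2 * (y \<bullet> (comb A l *v y)) - y \<bullet> comb b l + comb c l) has_derivative
      (\<lambda>h. 1/2 * (x \<bullet> (comb A l *v h) + h \<bullet> (comb A l *v x)) - h \<bullet> comb b l)) (at x)"
    by (auto intro!: derivative_eq_intros
        bounded_linear.has_derivative[OF matrix_vector_mul_bounded_linear])
  moreover have "(\<lambda>h. 1/2 * (x \<bullet> (comb A l *v h) + h \<bullet> (comb A l *v x)) - h \<bullet> comb b l)
      = (\<lambda>h. h \<bullet> (comb A l *v x - comb b l))"
    using inner_comb_symmetric[of A, OF assms] by (simp add: inner_diff_right fun_eq_iff)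
  ultimately show ?thesis
    by (simp add: gderiv_def lagr_eq inner_commute)
qed

lemma gderiv_lagr_0_iff:
  assumes "\<And>k. transpose (A k) = A k"
  shows "GDERIV (\<lambda>y. lagr A b c y l) x :> 0 \<longleftrightarrow> comb A l *v x = comb b l"
proof
  assume "GDERIV (\<lambda>y. lagr A b c y l) x :> 0"
  with gderiv_lagr[of A, OF assms] have "(\<lambda>h. h \<bullet> (comb A l *v x - comb b l)) = (\<lambda>h. h \<bullet> 0)"
    unfolding gderiv_def by (rule has_derivative_unique)
  \<comment> \<open>The functional vanishes, so it is evaluated at the very vector that represents
    it.\<close>
  then have "(comb A l *v x - comb b l) \<bullet> (comb A l *v x - comb b l) = 0"
    by (simp add: fun_eq_iff)
  then show "comb A l *v x = comb b l"
    by simp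
next
  assume "comb A l *v x = comb b l"
  then show "GDERIV (\<lambda>y. lagr A b c y l) x :> 0"
    using gderiv_lagr[of A, OF assms, of b c l x] by simp
qed

section \<open>Stability of invertibility and of positive definiteness along a line of
  matrices\<close>

lemma matrix_inv_mult_eq_iff:
  fixes M :: "real^'n^'n"
  assumes "det M \<noteq> 0"
  shows "M *v x = v \<longleftrightarrow> x = matrix_inv M *v v"
proof -
  have "invertible M"
    using assms by (simp add: invertible_det_nz)
  then have "M ** matrix_inv M = mat 1" "matrix_inv M ** M = mat 1"
    unfolding invertible_def matrix_inv_def by (metis (mono_tags, lifting) someI_ex)+
  then show ?thesis
    by (metis matrix_vector_mul_assoc matrix_vector_mul_lid)
qed

lemma det_nonzero_if_positive_definite:
  fixes M :: "real^'n^'n"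
  assumes "positive_definite M"
  shows "det M \<noteq> 0"
proof -
  have "x = 0" if "M *v x = 0" for x
    using assms that unfolding positive_definite_def by force
  then show ?thesis
    by (metis invertible_det_nz invertible_left_inverse matrix_left_invertible_ker)
qed

lemma det_nonzero_if_bounded_below:
  fixes M :: "real^'n^'n"
  assumes "B > 0" and "\<And>y. B * norm y \<le> norm (M *v y)"
  shows "det M \<noteq> 0"
proof -
  have "x = 0" if "M *v x = 0" for x
    using assms(2)[of x] that assms(1) by (simp add: mult_le_0_iff)
  then show ?thesis
    by (metis invertible_det_nz invertible_left_inverse matrix_left_invertible_ker)
qed

text \<open>An injective linear map in finite dimension is bounded below by some
  \<open>C > 0\<close>, and a perturbation of operator norm below \<open>C / 2\<close> costs at most
  half of it. That one B works for all small t is the point: it gives both solvability of the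
  perturbed systems and a uniform bound on how far their solutions move.\<close>

lemma bounded_below_perturbation:
  fixes M N :: "real^'n^'n"
  assumes "det M \<noteq> 0"
  obtains B where "B > 0" and "\<forall>\<^sub>F t in at 0. \<forall>y. B * norm y \<le> norm ((M + t *\<^sub>R N) *v y)"
proof -
  have "inj ((*v) M)"
    using assms by (simp add: inj_matrix_vector_mult invertible_det_nz)
  then obtain C where C: "C > 0" "\<And>y. C * norm y \<le> norm (M *v y)"
    using linear_inj_bounded_below_pos[of "(*v) M"] by (auto simp: mult.commute)
  have "((\<lambda>t. \<bar>t\<bar> * onorm ((*v) N)) \<longlongrightarrow> 0) (at 0)"
    by (auto intro!: tendsto_eq_intros)
  then have "\<forall>\<^sub>F t in at 0. \<bar>t\<bar> * onorm ((*v) N) < C / 2"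
    by (rule order_tendstoD(2)) (use C(1) in simp)
  then have "\<forall>\<^sub>F t in at 0. \<forall>y. C / 2 * norm y \<le> norm ((M + t *\<^sub>R N) *v y)"
  proof eventually_elim
    case (elim t)
    show ?case
    proof
      fix y
      have "norm (t *\<^sub>R (N *v y)) \<le> \<bar>t\<bar> * onorm ((*v) N) * norm y"
        using onorm[OF matrix_vector_mul_bounded_linear[of N], of y]
        by (simp add: mult_left_mono mult.assoc)
      also have "\<dots> \<le> C / 2 * norm y"
        using elim by (intro mult_right_mono) auto
      finally have "C * norm y - C / 2 * norm y \<le> norm (M *v y) - norm (t *\<^sub>R (N *v y))"
        using C(2)[of y] by linarith
      also have "\<dots> \<le> norm (M *v y + t *\<^sub>R (N *v y))"
        by (rule norm_diff_ineq)
      finally show "C / 2 * norm y \<le> norm ((M + t *\<^sub>R N) *v y)"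
        by (simp add: matrix_vector_mult_add_rdistrib flip: scaleR_matrix_vector_assoc)
    qed
  qed
  with C(1) that[of "C / 2"] show thesis by simp
qed

text \<open>By compactness the quadratic form of M has a positive minimum C on the unit sphere.
  There the perturbation contributes less than C in absolute value once \<bar>t\<bar> times the
  operator norm of N is below C, and homogeneity extends positivity to all nonzero vectors.\<close>

lemma positive_definite_perturbation:
  fixes M N :: "real^'n^'n"
  assumes M: "positive_definite M" and N: "transpose N = N"
  shows "\<forall>\<^sub>F t in at 0. positive_definite (M + t *\<^sub>R N)"
proof -
  let ?S = "sphere (0 :: real^'n) 1"
  have "continuous_on ?S (\<lambda>y. y \<bullet> (M *v y))"
    by (intro continuous_intros matrix_vector_mult_linear_continuous_on)
  moreover have "?S \<noteq> {}" by simp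
  ultimately obtain z where z: "z \<in> ?S" "\<And>y. y \<in> ?S \<Longrightarrow> z \<bullet> (M *v z) \<le> y \<bullet> (M *v y)"
    using continuous_attains_inf[OF compact_sphere] by blast
  define C where "C = z \<bullet> (M *v z)"
  have "z \<noteq> 0" using z(1) by auto
  then have C: "C > 0"
    using M by (simp add: C_def positive_definite_def)
  have "((\<lambda>t. \<bar>t\<bar> * onorm ((*v) N)) \<longlongrightarrow> 0) (at 0)"
    by (auto intro!: tendsto_eq_intros)
  then have "\<forall>\<^sub>F t in at 0. \<bar>t\<bar> * onorm ((*v) N) < C"
    by (rule order_tendstoD(2)) (use C in simp)
  then show ?thesis
  proof eventually_elim
    case (elim t)
    have "x \<bullet> ((M + t *\<^sub>R N) *v x) > 0" if "x \<noteq> 0" for x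
    proof -
      define u where "u = x /\<^sub>R norm x"
      have u: "norm u = 1" "x = norm x *\<^sub>R u"
        using that by (simp_all add: u_def)
      have "\<bar>u \<bullet> (N *v u)\<bar> \<le> onorm ((*v) N)"
        using Cauchy_Schwarz_ineq2[of u "N *v u"] onorm[OF matrix_vector_mul_bounded_linear[of N], of u] u
        by simp
      then have "\<bar>t * (u \<bullet> (N *v u))\<bar> \<le> \<bar>t\<bar> * onorm ((*v) N)"
        by (simp add: abs_mult mult_left_mono)
      moreover have "C \<le> u \<bullet> (M *v u)"
        using z(2)[of u] u(1) by (simp add: C_def)
      ultimately have "u \<bullet> (M *v u) + t * (u \<bullet> (N *v u)) > 0"
        using elim by linarith
      then have "u \<bullet> ((M + t *\<^sub>R N) *v u) > 0"
        by (simp add: matrix_vector_mult_add_rdistrib inner_add_right flip: scaleR_matrix_vector_assoc)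
      moreover have "x \<bullet> ((M + t *\<^sub>R N) *v x) = (norm x)\<^sup>2 * (u \<bullet> ((M + t *\<^sub>R N) *v u))"
        by (subst (1 2) u(2)) (simp add: matrix_vector_mult_scaleR power2_eq_square)
      ultimately show ?thesis
        using that by simp
    qed
    moreover have "transpose (M + t *\<^sub>R N) = M + t *\<^sub>R N"
      using M N by (simp add: positive_definite_def transpose_def vec_eq_iff)
    ultimately show ?case
      by (simp add: positive_definite_def)
  qed
qed

section \<open>Partial derivatives of the dual function on \<open>Y0 A\<close>\<close>

lemma has_derivative_dual:
  assumes sym: "\<And>k. transpose (A k) = A k" and l: "l \<in> Y0 A" and x: "comb A l *v x = comb b l"
  shows "((\<lambda>t. dual A b c (l + t *\<^sub>R axis j 1)) has_real_derivative quad A b c (Some j) x) (at 0)"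
proof -
  define M where "M t = comb A l + t *\<^sub>R A (Some j)" for t
  \<comment> \<open>Since x solves the system at t = 0, the residual of the fixed x in the system at
    \<open>l + t *\<^sub>R axis j 1\<close> is exactly \<open>t *\<^sub>R w\<close>.\<close>
  define w where "w = A (Some j) *v x - b (Some j)"
  define d where "d t = dual A b c (l + t *\<^sub>R axis j 1)" for t
  let ?q = "quad A b c (Some j) x"
  obtain B where B: "B > 0" "\<forall>\<^sub>F t in at 0. \<forall>y. B * norm y \<le> norm (M t *v y)"
    unfolding M_def using bounded_below_perturbation l by (auto simp: Y0_def)
  \<comment> \<open>For fixed x the Lagrangian is affine in the multiplier, with slope
    \<open>?q\<close> in direction j; at t = 0 it agrees with the dual because x solves the system
    there.\<close>
  have lin: "lagr A b c x (l + t *\<^sub>R axis j 1) = d 0 + t * ?q" for t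
  proof -
    have "lagr A b c x l' = comb (\<lambda>k. quad A b c k x) l'" for l'
      by (simp add: lagr_def comb_split)
    then show ?thesis
      using dual_eq[of A, OF sym x] by (simp add: d_def comb_add_axis)
  qed
  have "\<forall>\<^sub>F t in at 0. norm ((d t - d 0) / t - ?q) \<le> \<bar>t\<bar> * ((norm w)\<^sup>2 / B)"
    using B(2) eventually_neq_at_within[of 0 0]
  proof eventually_elim
    case (elim t)
    have "det (M t) \<noteq> 0"
      using det_nonzero_if_bounded_below[OF B(1)] elim(1) by blast
    then obtain z where z: "M t *v z = comb b (l + t *\<^sub>R axis j 1)"
      using matrix_inv_mult_eq_iff by blast
    have Mw: "M t *v (x - z) = t *\<^sub>R w"
      by (simp add: matrix_vector_mult_diff_distrib z)
        (simp add: M_def w_def comb_add_axis x matrix_vector_mult_add_rdistrib scaleR_diff_right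
          flip: scaleR_matrix_vector_assoc)
    \<comment> \<open>The square is completed around the solution z at parameter t and evaluated at
      the old solution x. The remainder is second order: one factor t is explicit, the other sits in
      \<open>x - z\<close>.\<close>
    have "d 0 + t * ?q = d t + 1/2 * ((x - z) \<bullet> (t *\<^sub>R w))"
      using lagr_complete_square[of A "l + t *\<^sub>R axis j 1" z b c x, OF sym] z Mw
      by (simp add: lin d_def M_def comb_add_axis)
    then have "(d t - d 0) / t - ?q = - (1/2 * ((x - z) \<bullet> w))"
      using elim(2) by (simp add: field_simps)
    then have "norm ((d t - d 0) / t - ?q) = 1/2 * \<bar>(x - z) \<bullet> w\<bar>"
      by simp
    also have "\<dots> \<le> norm (x - z) * norm w"
      using Cauchy_Schwarz_ineq2[of "x - z" w] by simp
    also have "norm (x - z) * norm w \<le> (\<bar>t\<bar> * norm w / B) * norm w"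
    proof (rule mult_right_mono)
      \<comment> \<open>The uniform lower bound B turns the residual \<open>t *\<^sub>R w\<close>
        into a displacement of the solution that is linear in t.\<close>
      show "norm (x - z) \<le> \<bar>t\<bar> * norm w / B"
        using elim(1)[rule_format, of "x - z"] B(1) by (simp add: Mw pos_le_divide_eq mult.commute)
    qed simp
    finally show ?case
      using B(1) by (simp add: power2_eq_square)
  qed
  moreover have "((\<lambda>t. \<bar>t\<bar> * ((norm w)\<^sup>2 / B)) \<longlongrightarrow> 0) (at 0)"
    by (intro tendsto_mult_left_zero tendsto_rabs_zero tendsto_ident_at)
  ultimately have "((\<lambda>t. (d t - d 0) / t - ?q) \<longlongrightarrow> 0) (at 0)"
    by (rule Lim_null_comparison)
  then show ?thesis
    unfolding DERIV_def d_def[symmetric] by (simp add: LIM_zero_iff)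
qed

lemma partial_deriv_dual:
  assumes "\<And>k. transpose (A k) = A k" "l \<in> Y0 A" "comb A l *v x = comb b l"
  shows "partial_deriv (dual A b c) j l = quad A b c (Some j) x"
proof -
  have "((\<lambda>t. dual A b c (l + t *\<^sub>R axis j 1)) has_real_derivative quad A b c (Some j) x) (at 0)"
    by (rule has_derivative_dual[of A, OF assms])
  then show ?thesis
    unfolding partial_deriv_def by (rule DERIV_imp_deriv)
qed

section \<open>LKKT points of L and D, and the optimality they imply\<close>

lemma feasible_iff:
  "x \<in> feasible A b c J \<longleftrightarrow>
    (\<forall>j\<in>J. quad A b c (Some j) x = 0) \<and> (\<forall>j\<in>-J. quad A b c (Some j) x \<le> 0)"
  unfolding feasible_def mem_Collect_eq ..

lemma GammaJ_iff: "l \<in> GammaJ J \<longleftrightarrow> (\<forall>j\<in>-J. l $ j \<ge> 0)"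
  unfolding GammaJ_def mem_Collect_eq ..

lemma LKKT_L_iff:
  assumes "\<And>k. transpose (A k) = A k"
  shows "LKKT_L A b c J x l \<longleftrightarrow> comb A l *v x = comb b l \<and> x \<in> feasible A b c J \<and> l \<in> GammaJ J \<and>
    (\<forall>j\<in>-J. l $ j * quad A b c (Some j) x = 0)"
proof -
  have gradient: "GDERIV (\<lambda>y. lagr A b c y l) x :> 0 \<longleftrightarrow> comb A l *v x = comb b l"
    by (rule gderiv_lagr_0_iff[of A, OF assms])
  show ?thesis
    unfolding LKKT_L_def partial_deriv_lagr gradient feasible_iff GammaJ_iff by blast
qed

text \<open>Both functions have the partial derivatives \<open>quad A b c (Some j) x\<close> at l,
  so the sign and complementarity conditions coincide; the remaining condition, stationarity in x,
  is the assumed linear system.\<close>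

lemma LKKT_D_iff_LKKT_L:
  assumes "\<And>k. transpose (A k) = A k" "l \<in> Y0 A" "comb A l *v x = comb b l"
  shows "LKKT_D A b c J l \<longleftrightarrow> LKKT_L A b c J x l"
proof -
  have partial: "partial_deriv (dual A b c) j l = quad A b c (Some j) x" for j
    by (rule partial_deriv_dual[of A, OF assms])
  have L: "LKKT_L A b c J x l \<longleftrightarrow> x \<in> feasible A b c J \<and> l \<in> GammaJ J \<and>
      (\<forall>j\<in>-J. l $ j * quad A b c (Some j) x = 0)"
    using LKKT_L_iff[of A, OF assms(1)] assms(3) by simp
  show ?thesis
    unfolding L LKKT_D_def partial feasible_iff GammaJ_iff using assms(2) by blast
qed

text \<open>Feasibility on J and complementarity off J make every term of the multiplier sum
  vanish.\<close>

lemma LKKT_L_quad_eq_lagr: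
  assumes "\<And>k. transpose (A k) = A k" and "LKKT_L A b c J x l"
  shows "quad A b c None x = lagr A b c x l"
proof -
  have "l $ j * quad A b c (Some j) x = 0" for j
    using assms(2) by (cases "j \<in> J") (auto simp: LKKT_L_iff[of A, OF assms(1)] feasible_def)
  then show ?thesis
    unfolding lagr_def by (simp only: sum.neutral_const add_0_right)
qed

text \<open>Weak duality separates all primal values from all dual values, and the LKKT point
  attains a common value on both sides. Taking the bounds in \<open>ereal\<close> avoids side
  conditions on boundedness.\<close>

lemma LKKT_L_optimal:
  assumes sym: "\<And>k. transpose (A k) = A k" and "LKKT_L A b c J x l" and l: "l \<in> YcolJp A b J"
  shows "(INF y\<in>feasible A b c J. ereal (quad A b c None y)) = ereal (lagr A b c x l)"
    and "(SUP l\<in>YcolJp A b J. ereal (dual A b c l)) = ereal (dual A b c l)"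
proof -
  have x: "comb A l *v x = comb b l" "x \<in> feasible A b c J"
    using assms(2) by (simp_all add: LKKT_L_iff[of A, OF sym])
  note dual = dual_eq[of A, OF sym x(1), of c]
  note quad = LKKT_L_quad_eq_lagr[of A, OF sym assms(2)]
  have weak: "dual A b c l' \<le> quad A b c None y" if "y \<in> feasible A b c J" "l' \<in> YcolJp A b J" for y l'
    using dual_le_lagr[of A, OF sym, of l' b c y] lagr_le_quad[OF that(1), of l'] that(2)
    by (simp add: YcolJp_def)
  show "(INF y\<in>feasible A b c J. ereal (quad A b c None y)) = ereal (lagr A b c x l)"
  proof (rule antisym)
    show "(INF y\<in>feasible A b c J. ereal (quad A b c None y)) \<le> ereal (lagr A b c x l)"
      unfolding quad[symmetric] using x(2) by (rule INF_lower)
    show "ereal (lagr A b c x l) \<le> (INF y\<in>feasible A b c J. ereal (quad A b c None y))"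
      unfolding dual[symmetric] using weak[OF _ l] by (intro INF_greatest) simp
  qed
  show "(SUP l\<in>YcolJp A b J. ereal (dual A b c l)) = ereal (dual A b c l)"
  proof (rule antisym)
    show "(SUP l\<in>YcolJp A b J. ereal (dual A b c l)) \<le> ereal (dual A b c l)"
      unfolding dual quad[symmetric] using weak[OF x(2)] by (intro SUP_least) simp
    show "ereal (dual A b c l) \<le> (SUP l\<in>YcolJp A b J. ereal (dual A b c l))"
      using l by (rule SUP_upper)
  qed
qed

text \<open>With a positive definite matrix the square remainder is strictly positive away from x,
  which makes the duality inequality strict for every other feasible point.\<close>

lemma LKKT_L_unique_minimizer:
  assumes sym: "\<And>k. transpose (A k) = A k" and L: "LKKT_L A b c J x l" and l: "l \<in> YJp A J"
  shows "is_arg_min (quad A b c None) (\<lambda>y. y \<in> feasible A b c J) y \<longleftrightarrow> y = x"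
proof -
  have x: "comb A l *v x = comb b l" "x \<in> feasible A b c J"
    using L by (simp_all add: LKKT_L_iff[of A, OF sym])
  have less: "quad A b c None x < quad A b c None z" if "z \<in> feasible A b c J" "z \<noteq> x" for z
  proof -
    have "quad A b c None x = dual A b c l"
      using LKKT_L_quad_eq_lagr[of A, OF sym L] dual_eq[of A, OF sym x(1)] by simp
    also have "\<dots> < lagr A b c z l"
      using l that(2) by (simp add: lagr_complete_square[of A, OF sym x(1)] YJp_def Yp_def positive_definite_def)
    also have "\<dots> \<le> quad A b c None z"
      using lagr_le_quad[OF that(1)] l by (simp add: YJp_def)
    finally show ?thesis .
  qed
  show ?thesis
    unfolding is_arg_min_def using x(2) less by (metis less_asym)
qed

section \<open>Inclusions between the multiplier sets, and necessary conditions at a dual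
  maximizer\<close>

lemma Yp_subset_Y0: "Yp A \<subseteq> Y0 A"
  unfolding Yp_def Y0_def by (intro Collect_mono impI det_nonzero_if_positive_definite)

lemma in_Ycol:
  assumes "comb A l *v x = comb b l"
  shows "l \<in> Ycol A b"
  unfolding Ycol_def mem_Collect_eq by (rule range_eqI) (rule assms[symmetric])

lemma Y0_subset_Ycol: "Y0 A \<subseteq> Ycol A b"
proof
  fix l assume "l \<in> Y0 A"
  then have "comb A l *v (matrix_inv (comb A l) *v comb b l) = comb b l"
    by (simp add: Y0_def matrix_inv_mult_eq_iff)
  then show "l \<in> Ycol A b" by (rule in_Ycol)
qed

lemma YJp_subset_YcolJp: "YJp A J \<subseteq> YcolJp A b J"
proof
  fix l assume l: "l \<in> YJp A J"
  then have "l \<in> Ycol A b"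
    using Yp_subset_Y0[of A] Y0_subset_Ycol[of A b] by (auto simp: YJp_def)
  moreover have "positive_semidefinite (comb A l)"
  proof -
    have "x \<bullet> (comb A l *v x) \<ge> 0" for x
      using l by (cases "x = 0") (auto simp: YJp_def Yp_def positive_definite_def less_imp_le)
    then show ?thesis
      using l by (simp add: YJp_def Yp_def positive_definite_def positive_semidefinite_def)
  qed
  ultimately show "l \<in> YcolJp A b J"
    using l by (simp add: YJp_def YcolJp_def Ycolp_def)
qed

lemma LKKT_D_if_maximizer:
  assumes sym: "\<And>k. transpose (A k) = A k" and l: "l \<in> YJp A J"
    and max: "\<And>l'. l' \<in> YJp A J \<Longrightarrow> dual A b c l' \<le> dual A b c l"
  shows "LKKT_D A b c J l"
proof -
  have l0: "l \<in> Y0 A" and lp: "positive_definite (comb A l)" and lG: "\<And>j. j \<notin> J \<Longrightarrow> l $ j \<ge> 0"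
    using l Yp_subset_Y0[of A] by (auto simp: YJp_def Yp_def GammaJ_def)
  obtain x where x: "comb A l *v x = comb b l"
    using l0 Y0_subset_Ycol[of A b] by (auto simp: Ycol_def)
  define g where "g j t = dual A b c (l + t *\<^sub>R axis j 1)" for j t
  have deriv: "(g j has_real_derivative partial_deriv (dual A b c) j l) (at 0)" for j
    using has_derivative_dual[of A, OF sym l0 x] unfolding g_def partial_deriv_dual[of A, OF sym l0 x] .
  \<comment> \<open>A small coordinate move keeps the matrix positive definite, so only the sign of
    coordinate j can leave \<open>YJp A J\<close>, and for j in J that sign is unrestricted.\<close>
  have le: "\<forall>\<^sub>F t in at 0. (j \<in> J \<or> l $ j + t \<ge> 0) \<longrightarrow> g j t \<le> g j 0" for j
    using positive_definite_perturbation[OF lp sym[of "Some j"]]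
  proof eventually_elim
    case (elim t)
    show ?case
    proof
      assume "j \<in> J \<or> l $ j + t \<ge> 0"
      then have "l + t *\<^sub>R axis j 1 \<in> GammaJ J"
        using lG by (auto simp: GammaJ_def axis_def)
      with elim show "g j t \<le> g j 0"
        using max by (simp add: g_def YJp_def Yp_def comb_add_axis)
    qed
  qed
  \<comment> \<open>For such j small moves in both directions are admissible, so t = 0 is a local
    maximum of \<open>g j\<close> and its derivative vanishes.\<close>
  have zero: "partial_deriv (dual A b c) j l = 0" if "j \<in> J \<or> l $ j > 0" for j
  proof -
    have "\<forall>\<^sub>F t in at 0. j \<in> J \<or> l $ j + t \<ge> 0"
    proof (cases "j \<in> J")
      case False
      have "((\<lambda>t. l $ j + t) \<longlongrightarrow> l $ j + 0) (at 0)"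
        by (intro tendsto_intros)
      then have "\<forall>\<^sub>F t in at 0. 0 < l $ j + t"
        by (rule order_tendstoD(1)) (use that False in simp)
      then show ?thesis by eventually_elim simp
    qed simp
    with le[of j] have "\<forall>\<^sub>F t in at 0. g j t \<le> g j 0"
      by eventually_elim simp
    then obtain e where e: "e > 0" "\<And>t. t \<noteq> 0 \<Longrightarrow> \<bar>t\<bar> < e \<Longrightarrow> g j t \<le> g j 0"
      by (auto simp: eventually_at)
    \<comment> \<open>The filter \<open>at 0\<close> leaves out t = 0, where the inequality is
      trivial; \<open>DERIV_local_max\<close> needs the full interval.\<close>
    have "g j t \<le> g j 0" if "\<bar>0 - t\<bar> < e" for t
      using e(2)[of t] that by (cases "t = 0") auto
    with deriv e(1) show ?thesis
      by (blast intro: DERIV_local_max)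
  qed
  \<comment> \<open>Increasing a nonnegative coordinate is always admissible, whereas a positive
    derivative would make \<open>g j\<close> strictly larger just to the right of 0.\<close>
  have nonpos: "partial_deriv (dual A b c) j l \<le> 0" if "j \<notin> J" for j
  proof (rule ccontr)
    assume "\<not> ?thesis"
    then obtain e where e: "e > 0" "\<And>h. 0 < h \<Longrightarrow> h < e \<Longrightarrow> g j 0 < g j (0 + h)"
      using DERIV_pos_inc_right[OF deriv, of j] by auto
    obtain e' where e': "e' > 0" "\<And>t. t \<noteq> 0 \<Longrightarrow> \<bar>t\<bar> < e' \<Longrightarrow> l $ j + t \<ge> 0 \<Longrightarrow> g j t \<le> g j 0"
      using le[of j] by (auto simp: eventually_at)
    define h where "h = min e e' / 2"
    have "0 < h" "h < e" "h < e'"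
      using e(1) e'(1) by (auto simp: h_def)
    then show False
      using e(2)[of h] e'(2)[of h] lG[OF that] by simp
  qed
  show ?thesis
    unfolding LKKT_D_def
  proof (intro conjI ballI)
    show "l \<in> Y0 A" by (fact l0)
  next
    fix j assume j: "j \<in> - J"
    show "l $ j \<ge> 0" "partial_deriv (dual A b c) j l \<le> 0"
      using lG nonpos j by simp_all
    show "l $ j * partial_deriv (dual A b c) j l = 0"
    proof (cases "l $ j = 0")
      case False
      then have "partial_deriv (dual A b c) j l = 0"
        using lG[of j] j by (intro zero) simp
      then show ?thesis by simp
    qed simp
  next
    fix j assume "j \<in> J"
    then show "partial_deriv (dual A b c) j l = 0" by (intro zero) simp
  qed
qed

section \<open>Assembly of (i), (ii) and (iii)\<close>

theorem proposition9:
  fixes A :: "'m::finite option \<Rightarrow> real^'n^'n"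
    and b :: "'m option \<Rightarrow> real^'n"
    and c :: "'m option \<Rightarrow> real"
    and J :: "'m set"
    and xb :: "real^'n" and lb :: "real^'m"
  assumes sym: "\<And>k. transpose (A k) = A k"
  shows
    "(LKKT_L A b c J xb lb \<longrightarrow>
        LKKT_P A b c J xb \<and> xb \<in> feasible A b c J \<and> lb \<in> YcolJ A b J \<and>
        quad A b c None xb = lagr A b c xb lb \<and> lagr A b c xb lb = dual A b c lb \<and>
        (lb \<in> YcolJp A b J \<longrightarrow>
           ereal (quad A b c None xb) = (INF x\<in>feasible A b c J. ereal (quad A b c None x)) \<and>
           (INF x\<in>feasible A b c J. ereal (quad A b c None x)) = ereal (lagr A b c xb lb) \<and>
           ereal (lagr A b c xb lb) = (SUP l\<in>YcolJp A b J. ereal (dual A b c l)) \<and>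
           (SUP l\<in>YcolJp A b J. ereal (dual A b c l)) = ereal (dual A b c lb))) \<and>

     (LKKT_L A b c J xb lb \<longrightarrow>
        (lb \<in> Y0 A \<longleftrightarrow> lb \<in> YJ A J) \<and>
        (lb \<in> Y0 A \<longrightarrow>
           xb = matrix_inv (comb A lb) *v comb b lb \<and> LKKT_D A b c J lb \<and>
           (lb \<in> YJp A J \<longrightarrow>
              (\<forall>x. is_arg_min (quad A b c None) (\<lambda>y. y \<in> feasible A b c J) x \<longleftrightarrow> x = xb)))) \<and>

     (LKKT_D A b c J lb \<longrightarrow>
        (\<forall>x. x = matrix_inv (comb A lb) *v comb b lb \<longrightarrow>
           LKKT_L A b c J x lb \<and>
           LKKT_P A b c J x \<and> x \<in> feasible A b c J \<and> lb \<in> YcolJ A b J \<and>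
           quad A b c None x = lagr A b c x lb \<and> lagr A b c x lb = dual A b c lb \<and>
           (lb \<in> YcolJp A b J \<longrightarrow>
              ereal (quad A b c None x) = (INF y\<in>feasible A b c J. ereal (quad A b c None y)) \<and>
              (INF y\<in>feasible A b c J. ereal (quad A b c None y)) = ereal (lagr A b c x lb) \<and>
              ereal (lagr A b c x lb) = (SUP l\<in>YcolJp A b J. ereal (dual A b c l)) \<and>
              (SUP l\<in>YcolJp A b J. ereal (dual A b c l)) = ereal (dual A b c lb)) \<and>
           lb \<in> YJ A J \<and>
           (lb \<in> YJp A J \<longrightarrow>
              (\<forall>y. is_arg_min (quad A b c None) (\<lambda>z. z \<in> feasible A b c J) y \<longleftrightarrow> y = x)))) \<and>

     (lb \<in> YJp A J \<longrightarrow>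
        (ereal (dual A b c lb) = (SUP l\<in>YcolJp A b J. ereal (dual A b c l)) \<longleftrightarrow>
         ereal (dual A b c lb) = (SUP l\<in>YJp A J. ereal (dual A b c l))) \<and>
        (ereal (dual A b c lb) = (SUP l\<in>YJp A J. ereal (dual A b c l)) \<longleftrightarrow>
         LKKT_D A b c J lb))"
proof -
  \<comment> \<open>Stated for arbitrary x, because it is applied both to the given
    \<open>xb\<close> and to the point recovered from an LKKT point of D.\<close>
  have part_i: "LKKT_P A b c J x \<and> x \<in> feasible A b c J \<and> lb \<in> YcolJ A b J \<and>
        quad A b c None x = lagr A b c x lb \<and> lagr A b c x lb = dual A b c lb \<and>
        (lb \<in> YcolJp A b J \<longrightarrow>
           ereal (quad A b c None x) = (INF y\<in>feasible A b c J. ereal (quad A b c None y)) \<and>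
           (INF y\<in>feasible A b c J. ereal (quad A b c None y)) = ereal (lagr A b c x lb) \<and>
           ereal (lagr A b c x lb) = (SUP l\<in>YcolJp A b J. ereal (dual A b c l)) \<and>
           (SUP l\<in>YcolJp A b J. ereal (dual A b c l)) = ereal (dual A b c lb))"
    if L: "LKKT_L A b c J x lb" for x
  proof -
    have x: "comb A lb *v x = comb b lb" "x \<in> feasible A b c J" "lb \<in> GammaJ J"
      using L by (simp_all add: LKKT_L_iff[of A, OF sym])
    have "LKKT_P A b c J x"
      using L by (auto simp: LKKT_P_def)
    moreover have "lb \<in> YcolJ A b J"
      using x(3) in_Ycol[OF x(1)] by (simp add: YcolJ_def)
    ultimately show ?thesis
      using x(2) LKKT_L_quad_eq_lagr[of A, OF sym L] dual_eq[of A, OF sym x(1), of c] LKKT_L_optimal[of A, OF sym L]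
      by simp
  qed
  have YJ: "lb \<in> YJ A J \<longleftrightarrow> lb \<in> Y0 A" if "LKKT_L A b c J x lb" for x
    using that by (auto simp: LKKT_L_iff[of A, OF sym] YJ_def)
  have solution: "comb A lb *v x = comb b lb \<longleftrightarrow> x = matrix_inv (comb A lb) *v comb b lb"
    if "lb \<in> Y0 A" for x
    using that by (intro matrix_inv_mult_eq_iff) (simp add: Y0_def)
  \<comment> \<open>This gives both directions of (ii): on \<open>Y0 A\<close> the linear system
    determines x, so an LKKT point of L is an LKKT point of D together with its unique
    solution.\<close>
  have L_iff_D: "LKKT_L A b c J x lb \<longleftrightarrow> x = matrix_inv (comb A lb) *v comb b lb \<and> LKKT_D A b c J lb"
    if "lb \<in> Y0 A" for x
    using LKKT_D_iff_LKKT_L[of A, OF sym that] solution[OF that, of x] LKKT_L_iff[of A, OF sym] by metis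
  have D_Y0: "lb \<in> Y0 A" if "LKKT_D A b c J lb"
    using that by (simp add: LKKT_D_def)
  have part_iii:
    "(ereal (dual A b c lb) = (SUP l\<in>YcolJp A b J. ereal (dual A b c l)) \<longleftrightarrow>
        ereal (dual A b c lb) = (SUP l\<in>YJp A J. ereal (dual A b c l))) \<and>
     (ereal (dual A b c lb) = (SUP l\<in>YJp A J. ereal (dual A b c l)) \<longleftrightarrow> LKKT_D A b c J lb)"
    (is "(?col \<longleftrightarrow> ?reg) \<and> (?reg \<longleftrightarrow> _)") if lb: "lb \<in> YJp A J"
  proof -
    note subset = YJp_subset_YcolJp[of A J b]
    \<comment> \<open>The equivalences are closed as a cycle. First, a maximizer over the larger set
      that lies in the smaller one is a maximizer there too.\<close>
    have "?reg" if ?col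
    proof (rule antisym)
      show "ereal (dual A b c lb) \<le> (SUP l\<in>YJp A J. ereal (dual A b c l))"
        using lb by (rule SUP_upper)
      show "(SUP l\<in>YJp A J. ereal (dual A b c l)) \<le> ereal (dual A b c lb)"
        unfolding that using subset by (rule SUP_subset_mono) simp
    qed
    moreover have "LKKT_D A b c J lb" if ?reg
    proof (rule LKKT_D_if_maximizer[of A, OF sym lb])
      fix l assume "l \<in> YJp A J"
      then have "ereal (dual A b c l) \<le> ereal (dual A b c lb)"
        unfolding that by (rule SUP_upper)
      then show "dual A b c l \<le> dual A b c lb" by simp
    qed
    \<comment> \<open>The cycle closes through the primal side: the point recovered from the
      multiplier is an LKKT point of L, and part (i) applies because \<open>YJp A J\<close> lies in
      \<open>YcolJp A b J\<close>.\<close>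
    moreover have "?col" if "LKKT_D A b c J lb"
      using L_iff_D[OF D_Y0] that part_i lb subset by (metis subsetD)
    ultimately show ?thesis by blast
  qed
  show ?thesis
    using part_i YJ L_iff_D D_Y0 LKKT_L_unique_minimizer[of A, OF sym] part_iii
    by (intro conjI impI allI) (blast | simp)+
qed

end
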